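(* Let $1\le\alpha\le N$ and $\mathbf v=(v_1,\dots,v_\alpha)$. The generating multi-current $\mathfrak M_\alpha(\mathbf v)=\sum_{a_1,\dots,a_\alpha\in\mathbb Z}\mathcal M_{a_1,\dots,a_\alpha}v_1^{a_1}\cdots v_\alpha^{a_\alpha}$ of the generalized Macdonald operators $\mathcal M_{a_1,\dots,a_\alpha}$ is $$\mathfrak M_\alpha(\mathbf v)=\prod_{1\le i<j\le\alpha}\frac{v_i-qv_j}{(t-v_iv_j^{-1})(tv_i-qv_j)}\ \prod_{i=1}^\alpha\mathfrak m(v_i),$$ where $\prod_{i=1}^\alpha\mathfrak m(v_i)=\mathfrak m(v_1)\mathfrak m(v_2)\cdots\mathfrak m(v_\alpha)$.
   Context: $q,t$ are indeterminates; operators act on symmetric rational functions of $x_1,\dots,x_N$ over $\mathbb C(q,t)$; $\Gamma_i$ is the shift $x_i\mapsto qx_i$. For $(a_1,\dots,a_\alpha)\in\mathbb Z^\alpha$ the generalized Schur function is $$s_{a_1,\dots,a_\alpha}(x_1,\dots,x_\alpha)=\frac{\det_{1\le i,j\le\alpha}\big(x_i^{a_j+\alpha-j}\big)}{\prod_{1\le i<j\le\alpha}(x_i-x_j)},$$ and $$\mathcal M_{a_1,\dots,a_\alpha}=\sum_{I\subset[1,N],\,|I|=\alpha}s_{a_1,\dots,a_\alpha}(\mathbf x_I)\prod_{i\in I,\,j\notin I}\frac{tx_i-x_j}{x_i-x_j}\prod_{i\in I}\Gamma_i,\qquad \mathbf x_I=(x_i)_{i\in I}.$$ With $\delta(u)=\sum_{n\in\mathbb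 Z}u^n$, $$\mathfrak m(u)=\sum_{n\in\mathbb Z}u^n\mathcal M_n=\sum_{i=1}^N\delta(ux_i)\prod_{j\ne i}\frac{tx_i-x_j}{x_i-x_j}\,\Gamma_i .$$ Convention: $\mathfrak m(v_1)\cdots\mathfrak m(v_\alpha)$ is a finite sum of terms $c\prod_k\delta(v_ky_k)\,\Gamma$, where each $y_k$ is a power of $q$ times one of the $x_i$, $c$ is a rational function of the $x_i$ and $\Gamma$ is a product of shifts; a rational function $R(\mathbf v)$ regular at $v_k=y_k^{-1}$ multiplies such a term by $R(\mathbf v)\prod_k\delta(v_ky_k)=R(y_1^{-1},\dots,y_\alpha^{-1})\prod_k\delta(v_ky_k)$. *)

theory Defs
  imports
    "HOL-Library.Cardinality"
    "HOL-Library.Poly_Mapping"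
    "HOL-Library.FuncSet"
    "HOL-Computational_Algebra.Computational_Algebra"
    "Jordan_Normal_Form.Determinant"
begin

section \<open>Rational functions over C(q,t)\<close>

text \<open>
  The base field C(q,t) is the fraction field of C[q][t]. Polynomials in variables indexed by
  \<open>'v\<close> are finitely supported maps from exponent vectors to coefficients, and \<open>'v ratfun\<close> is
  their fraction field. The linear order required on \<open>'v\<close> only serves to make the polynomial
  ring an instance of \<open>idom\<close>. The same type constructor is used for the rational functions of
  \<open>x\<^sub>1, \<dots>, x\<^sub>N\<close> (with \<open>'v\<close> a finite type \<open>'n\<close> with \<open>N\<close> elements) and for those of
  \<open>v\<^sub>1, v\<^sub>2, \<dots>\<close> (with \<open>'v = nat\<close>, counting from 0).
\<close>

type_synonym scalar = "complex poly poly fract"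
type_synonym 'v polyn = "('v \<Rightarrow>\<^sub>0 nat) \<Rightarrow>\<^sub>0 scalar"
type_synonym 'v ratfun = "'v polyn fract"

definition const :: "scalar \<Rightarrow> 'v::linorder ratfun" where
  "const c = Fract (Poly_Mapping.single 0 c) 1"

definition var :: "'v::linorder \<Rightarrow> 'v ratfun" where
  "var i = Fract (Poly_Mapping.single (Poly_Mapping.single i 1) 1) 1"

definition q :: "'v::linorder ratfun" where
  "q = const (Fract [:[:0, 1:]:] 1)"

definition t :: "'v::linorder ratfun" where
  "t = const (Fract [:0, 1:] 1)"

text \<open>Substitution of rational functions \<open>p i\<close> for the variables.\<close>

definition eval_polyn :: "'v polyn \<Rightarrow> ('v \<Rightarrow> 'w ratfun) \<Rightarrow> 'w::linorder ratfun" where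
  "eval_polyn P p =
     (\<Sum>m\<in>Poly_Mapping.keys P.
        const (Poly_Mapping.lookup P m) *
        (\<Prod>i\<in>Poly_Mapping.keys m. p i ^ Poly_Mapping.lookup m i))"

definition regular_at :: "'v::linorder ratfun \<Rightarrow> ('v \<Rightarrow> 'w::linorder ratfun) \<Rightarrow> bool" where
  "regular_at R p \<longleftrightarrow> (\<exists>P Q. R = Fract P Q \<and> eval_polyn Q p \<noteq> 0)"

text \<open>Only meaningful if \<open>R\<close> is regular at \<open>p\<close>; then the value does not depend on the fraction.\<close>

definition eval_ratfun :: "'v::linorder ratfun \<Rightarrow> ('v \<Rightarrow> 'w::linorder ratfun) \<Rightarrow> 'w ratfun" where
  "eval_ratfun R p =
     (THE z. \<exists>P Q. R = Fract P Q \<and> eval_polyn Q p \<noteq> 0 \<and> z = eval_polyn P p / eval_polyn Q p)"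

definition symmetric_ratfuns :: "'n::linorder ratfun set" where
  "symmetric_ratfuns = {f. \<forall>\<pi>. bij \<pi> \<longrightarrow> eval_ratfun f (\<lambda>i. var (\<pi> i)) = f}"


section \<open>Generalized Macdonald operators\<close>

type_synonym 'n operator = "'n ratfun \<Rightarrow> 'n ratfun"

definition shift :: "'n::linorder \<Rightarrow> 'n operator" where
  "shift i f = eval_ratfun f (\<lambda>j. if j = i then q * var j else var j)"

definition shifts :: "'n::linorder list \<Rightarrow> 'n operator" where
  "shifts js = foldr (\<lambda>j F. shift j \<circ> F) js id"

text \<open>
  Lists are indexed from 0, so the exponent \<open>a\<^sub>j + \<alpha> - j\<close> reads \<open>a ! j + \<alpha> - 1 - j\<close>.
\<close>

definition gen_schur :: "int list \<Rightarrow> 'a::field list \<Rightarrow> 'a" where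
  "gen_schur a xs = (let \<alpha> = length a in
     det (mat \<alpha> \<alpha> (\<lambda>(i, j). (xs ! i) powi (a ! j + int \<alpha> - 1 - int j))) /
     (\<Prod>j<\<alpha>. \<Prod>i<j. xs ! i - xs ! j))"

text \<open>
  The subset \<open>I\<close> is enumerated in increasing order. This choice is immaterial: \<open>gen_schur a\<close> is a
  symmetric function and the shifts commute.
\<close>

definition macdonald :: "int list \<Rightarrow> 'n::{finite,linorder} operator" where
  "macdonald a f =
     (\<Sum>I | card I = length a.
        gen_schur a (map var (sorted_list_of_set I)) *
        (\<Prod>i\<in>I. \<Prod>j\<in>- I. (t * var i - var j) / (var i - var j)) *
        shifts (sorted_list_of_set I) f)"


section \<open>Currents\<close>

text \<open>
  A formal series in \<open>v\<^sub>1\<^sup>\<plusminus>\<^sup>1, \<dots>, v\<^sub>\<alpha>\<^sup>\<plusminus>\<^sup>1\<close> whose coefficients are operators on symmetric rational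
  functions is its coefficient family, indexed by the integer lists of length \<open>\<alpha>\<close>. Both the
  family and its members are restricted to their domains, so that equality of currents is
  coefficientwise equality of operators on symmetric functions.
\<close>

type_synonym 'n current = "int list \<Rightarrow> 'n operator"

definition current :: "nat \<Rightarrow> (int list \<Rightarrow> 'n::linorder operator) \<Rightarrow> 'n current" where
  "current \<alpha> A = (\<lambda>a\<in>{a. length a = \<alpha>}. \<lambda>f\<in>symmetric_ratfuns. A a f)"

definition multi_current :: "nat \<Rightarrow> 'n::{finite,linorder} current" where
  "multi_current \<alpha> = current \<alpha> macdonald"

text \<open>
  The product of the \<open>\<alpha>\<close> series \<open>\<Sum>n. v\<^sub>k\<^sup>n M\<^sub>n\<close> for \<open>k = 1, \<dots>, \<alpha>\<close>, in this order: its coefficient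
  of \<open>v\<^sup>a\<close> is the composition of the \<open>M\<close> of index \<open>a\<^sub>1, \<dots>, a\<^sub>\<alpha>\<close>.
\<close>

definition current_product :: "nat \<Rightarrow> 'n::{finite,linorder} current" where
  "current_product \<alpha> = current \<alpha> (\<lambda>a. foldr (\<lambda>n F. macdonald [n] \<circ> F) a id)"

text \<open>
  A triple \<open>(c, y, js)\<close> encodes the term \<open>c \<Prod>\<^sub>k \<delta>(v\<^sub>k y\<^sub>k) \<Gamma>\<close>, where \<open>\<Gamma>\<close> is the product of the
  shifts listed in \<open>js\<close>. The coefficient of \<open>v\<^sup>a\<close> in \<open>\<Prod>\<^sub>k \<delta>(v\<^sub>k y\<^sub>k)\<close> is \<open>\<Prod>\<^sub>k (y\<^sub>k ^ a\<^sub>k)\<close>.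
\<close>

type_synonym 'n delta_term = "'n ratfun \<times> 'n ratfun list \<times> 'n list"

definition delta_term :: "nat \<Rightarrow> 'n::linorder delta_term \<Rightarrow> bool" where
  "delta_term \<alpha> = (\<lambda>(c, y, js).
     length y = \<alpha> \<and> (\<forall>z\<in>set y. \<exists>(m::int) i. z = q powi m * var i))"

definition delta_sum :: "nat \<Rightarrow> 'n::linorder delta_term list \<Rightarrow> 'n current" where
  "delta_sum \<alpha> ts = current \<alpha> (\<lambda>a f.
     \<Sum>(c, y, js)\<leftarrow>ts. c * (\<Prod>k<\<alpha>. (y ! k) powi (a ! k)) * shifts js f)"

text \<open>
  The point \<open>v\<^sub>k = y\<^sub>k\<^sup>-\<^sup>1\<close>; the variables \<open>v\<^sub>k\<close> beyond the length of \<open>y\<close> are irrelevant and set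
  to 0.
\<close>

definition inverse_point :: "'n::linorder ratfun list \<Rightarrow> nat \<Rightarrow> 'n ratfun" where
  "inverse_point y k = (if k < length y then inverse (y ! k) else 0)"

text \<open>
  Multiplication of a current by a rational function \<open>R(v)\<close>: the current is written as a finite
  sum of terms \<open>c \<Prod>\<^sub>k \<delta>(v\<^sub>k y\<^sub>k) \<Gamma>\<close> at whose supports \<open>R\<close> is regular, and each term is multiplied by
  the value of \<open>R\<close> there. The result does not depend on the chosen terms, because products
  of delta functions with distinct supports are linearly independent over the field of
  rational functions.
\<close>

definition ratfun_times_current :: "nat \<Rightarrow> nat ratfun \<Rightarrow> 'n::linorder current \<Rightarrow> 'n current" where
  "ratfun_times_current \<alpha> R D =
     (THE D'. \<exists>ts. (\<forall>(c, y, js)\<in>set ts. delta_term \<alpha> (c, y, js) \<and> regular_at R (inverse_point y)) \<and>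
        D = delta_sum \<alpha> ts \<and>
        D' = delta_sum \<alpha> (map (\<lambda>(c, y, js). (eval_ratfun R (inverse_point y) * c, y, js)) ts))"

end

theory Submission
  imports Defs
begin

text \<open>
  Expanding the product gives one term for each word \<open>i\<^sub>1, \<dots>, i\<^sub>\<alpha>\<close> in the indices. If an index is
  repeated, then \<open>y\<^sub>l = q y\<^sub>k\<close> for some \<open>k < l\<close>, and the factor \<open>v\<^sub>k - q v\<^sub>l\<close> kills the term. If the
  indices are distinct, then \<open>y\<^sub>k\<close> is the variable of index \<open>i\<^sub>k\<close>, and the prefactor turns the
  coefficient into \<open>\<Prod>\<^sub>k\<^sub><\<^sub>l x\<^sub>k / (x\<^sub>k - x\<^sub>l)\<close> times a factor that only depends on the set \<open>I\<close> of
  indices. Summing over the orderings of \<open>I\<close> yields the generalized Schur function, by the Leibniz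
  expansion of the determinant and the antisymmetry of the Vandermonde product. The multiplication
  of a current by a rational function is well defined because the characters
  \<open>a \<mapsto> \<Prod>\<^sub>k y\<^sub>k ^ a\<^sub>k\<close> for distinct \<open>y\<close> are linearly independent.
\<close>

section \<open>Evaluation as a homomorphism\<close>

lemma const_0 [simp]: "const 0 = (0::'v::linorder ratfun)"
  by (simp add: const_def fract_collapse)

lemma const_1 [simp]: "const 1 = (1::'v::linorder ratfun)"
  by (simp add: const_def fract_collapse)

lemma const_add: "const (a + b) = (const a + const b :: 'v::linorder ratfun)"
  by (simp add: const_def single_add)

lemma const_mult: "const (a * b) = (const a * const b :: 'v::linorder ratfun)"
  by (simp add: const_def mult_single)

lemma const_eq_0_iff [simp]: "const a = (0::'v::linorder ratfun) \<longleftrightarrow> a = 0"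
proof -
  have "const a = (0::'v ratfun) \<longleftrightarrow> Poly_Mapping.single (0::'v \<Rightarrow>\<^sub>0 nat) a = 0"
    by (simp add: const_def Zero_fract_def eq_fract)
  also have "\<dots> \<longleftrightarrow> a = 0"
    by (metis lookup_single_eq lookup_zero single_zero)
  finally show ?thesis .
qed

definition eval_monom :: "('v \<Rightarrow>\<^sub>0 nat) \<Rightarrow> ('v \<Rightarrow> 'w ratfun) \<Rightarrow> 'w::linorder ratfun" where
  "eval_monom m p = (\<Prod>i\<in>Poly_Mapping.keys m. p i ^ Poly_Mapping.lookup m i)"

text \<open>Indices outside the support have exponent 0 and contribute the factor 1. Monomials with
  different supports can thus be put over a common index set, as additivity requires.\<close>

lemma eval_monom_superset:
  assumes "finite K" "Poly_Mapping.keys m \<subseteq> K"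
  shows "eval_monom m p = (\<Prod>i\<in>K. p i ^ Poly_Mapping.lookup m i)"
  unfolding eval_monom_def
  by (rule prod.mono_neutral_left) (use assms in \<open>auto simp: in_keys_iff\<close>)

lemma eval_monom_add: "eval_monom (m + n) p = eval_monom m p * eval_monom n p"
proof -
  let ?K = "Poly_Mapping.keys m \<union> Poly_Mapping.keys n"
  have "eval_monom (m + n) p = (\<Prod>i\<in>?K. p i ^ Poly_Mapping.lookup (m + n) i)"
    by (rule eval_monom_superset) (auto simp: Poly_Mapping.keys_add)
  also have "\<dots> = (\<Prod>i\<in>?K. p i ^ Poly_Mapping.lookup m i) * (\<Prod>i\<in>?K. p i ^ Poly_Mapping.lookup n i)"
    by (simp add: lookup_add power_add prod.distrib)
  also have "\<dots> = eval_monom m p * eval_monom n p"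
    by (simp flip: eval_monom_superset)
  finally show ?thesis .
qed

lemma eval_polyn_superset:
  assumes "finite K" "Poly_Mapping.keys P \<subseteq> K"
  shows "eval_polyn P p = (\<Sum>m\<in>K. const (Poly_Mapping.lookup P m) * eval_monom m p)"
  unfolding eval_polyn_def eval_monom_def[symmetric]
  by (rule sum.mono_neutral_left) (use assms in \<open>auto simp: in_keys_iff\<close>)

lemma eval_polyn_0 [simp]: "eval_polyn 0 p = 0"
  by (simp add: eval_polyn_def)

lemma eval_polyn_single: "eval_polyn (Poly_Mapping.single m c) p = const c * eval_monom m p"
  by (subst eval_polyn_superset[of "{m}"]) auto

lemma eval_polyn_1 [simp]: "eval_polyn 1 p = 1"
  using eval_polyn_single[of 0 1 p] by (simp add: eval_monom_def)

lemma eval_polyn_add: "eval_polyn (P + Q) p = eval_polyn P p + eval_polyn Q p"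
proof -
  let ?K = "Poly_Mapping.keys P \<union> Poly_Mapping.keys Q"
  have "eval_polyn (P + Q) p = (\<Sum>m\<in>?K. const (Poly_Mapping.lookup (P + Q) m) * eval_monom m p)"
    by (rule eval_polyn_superset) (auto simp: Poly_Mapping.keys_add)
  also have "\<dots> = (\<Sum>m\<in>?K. const (Poly_Mapping.lookup P m) * eval_monom m p) +
      (\<Sum>m\<in>?K. const (Poly_Mapping.lookup Q m) * eval_monom m p)"
    by (simp add: lookup_add const_add distrib_right sum.distrib)
  also have "\<dots> = eval_polyn P p + eval_polyn Q p"
    by (simp flip: eval_polyn_superset)
  finally show ?thesis .
qed

lemma eval_polyn_sum: "eval_polyn (\<Sum>x\<in>X. P x) p = (\<Sum>x\<in>X. eval_polyn (P x) p)"
  by (induction X rule: infinite_finite_induct) (auto simp: eval_polyn_add)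

lemma polyn_as_sum:
  "(\<Sum>m\<in>Poly_Mapping.keys P. Poly_Mapping.single m (Poly_Mapping.lookup P m)) = P"
  by (rule poly_mapping_eqI)
    (simp add: lookup_sum lookup_single when_def not_in_keys_iff_lookup_eq_zero sum.delta')

lemma eval_polyn_mult:
  fixes P Q :: "'v::linorder polyn"
  shows "eval_polyn (P * Q) p = eval_polyn P p * eval_polyn Q p"
proof -
  let ?mono = "\<lambda>P m. Poly_Mapping.single m (Poly_Mapping.lookup P m)"
  have "P * Q = (\<Sum>m\<in>Poly_Mapping.keys P. ?mono P m) * (\<Sum>n\<in>Poly_Mapping.keys Q. ?mono Q n)"
    by (simp add: polyn_as_sum)
  also have "\<dots> = (\<Sum>m\<in>Poly_Mapping.keys P. \<Sum>n\<in>Poly_Mapping.keys Q.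
      Poly_Mapping.single (m + n) (Poly_Mapping.lookup P m * Poly_Mapping.lookup Q n))"
    by (simp add: sum_product mult_single)
  finally have "eval_polyn (P * Q) p = (\<Sum>m\<in>Poly_Mapping.keys P. \<Sum>n\<in>Poly_Mapping.keys Q.
      (const (Poly_Mapping.lookup P m) * eval_monom m p) *
      (const (Poly_Mapping.lookup Q n) * eval_monom n p))"
    by (simp add: eval_polyn_sum eval_polyn_single const_mult eval_monom_add mult_ac)
  then show ?thesis
    by (simp add: eval_polyn_def eval_monom_def sum_product)
qed

text \<open>The relation under the definite description in \<open>eval_ratfun\<close>. It includes
  regularity, so one derivation by closure rules yields both regularity and the value.\<close>

definition has_value :: "'v::linorder ratfun \<Rightarrow> ('v \<Rightarrow> 'w::linorder ratfun) \<Rightarrow> 'w ratfun \<Rightarrow> bool" where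
  "has_value R p z \<longleftrightarrow>
     (\<exists>P Q. R = Fract P Q \<and> eval_polyn Q p \<noteq> 0 \<and> z = eval_polyn P p / eval_polyn Q p)"

lemma has_value_regular: "has_value R p z \<Longrightarrow> regular_at R p"
  by (auto simp: has_value_def regular_at_def)

text \<open>Cross-multiplying equal fractions gives a polynomial identity; evaluation preserves it,
  and the nonzero values of the denominators allow dividing back.\<close>

lemma has_value_unique:
  assumes "has_value R p z" "has_value R p z'"
  shows "z = z'"
proof -
  obtain P Q where "R = Fract P Q" "eval_polyn Q p \<noteq> 0" "z = eval_polyn P p / eval_polyn Q p"
    using assms(1) by (auto simp: has_value_def)
  moreover obtain P' Q' where "R = Fract P' Q'" "eval_polyn Q' p \<noteq> 0"
      "z' = eval_polyn P' p / eval_polyn Q' p"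
    using assms(2) by (auto simp: has_value_def)
  ultimately have *: "R = Fract P Q" "eval_polyn Q p \<noteq> 0" "z = eval_polyn P p / eval_polyn Q p"
      "Fract P Q = Fract P' Q'" "eval_polyn Q' p \<noteq> 0" "z' = eval_polyn P' p / eval_polyn Q' p"
    by simp_all
  then have "Q \<noteq> 0" "Q' \<noteq> 0" by auto
  with * have "P * Q' = P' * Q" by (simp add: eq_fract)
  then have "eval_polyn P p * eval_polyn Q' p = eval_polyn P' p * eval_polyn Q p"
    by (simp flip: eval_polyn_mult)
  with * show ?thesis by (simp add: frac_eq_eq)
qed

lemma eval_ratfun_eqI: "has_value R p z \<Longrightarrow> eval_ratfun R p = z"
  unfolding eval_ratfun_def has_value_def[symmetric]
  by (rule the_equality) (auto intro: has_value_unique)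

lemma has_value_const [intro]: "has_value (const c) p (const c)"
  unfolding has_value_def const_def[of c, where 'v='a]
  by (rule exI[of _ "Poly_Mapping.single 0 c"], rule exI[of _ 1])
    (simp add: eval_polyn_single eval_monom_def)

lemma has_value_1 [intro]: "has_value 1 p 1"
  using has_value_const[of 1] by simp

lemma has_value_var [intro]: "has_value (var i) p (p i)"
  unfolding has_value_def var_def
  by (rule exI[of _ "Poly_Mapping.single (Poly_Mapping.single i 1) 1"], rule exI[of _ 1])
    (simp add: eval_polyn_single eval_monom_def)

lemma has_value_add [intro]:
  assumes "has_value R p z" "has_value S p w"
  shows "has_value (R + S) p (z + w)"
proof -
  obtain P Q P' Q' where *: "R = Fract P Q" "eval_polyn Q p \<noteq> 0" "z = eval_polyn P p / eval_polyn Q p"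
      "S = Fract P' Q'" "eval_polyn Q' p \<noteq> 0" "w = eval_polyn P' p / eval_polyn Q' p"
    using assms by (auto simp: has_value_def)
  then have "Q \<noteq> 0" "Q' \<noteq> 0" by auto
  with * show ?thesis
    unfolding has_value_def
    by (intro exI[of _ "P * Q' + P' * Q"] exI[of _ "Q * Q'"])
      (simp add: eval_polyn_mult eval_polyn_add add_frac_eq)
qed

lemma has_value_mult [intro]:
  assumes "has_value R p z" "has_value S p w"
  shows "has_value (R * S) p (z * w)"
proof -
  obtain P Q P' Q' where *: "R = Fract P Q" "eval_polyn Q p \<noteq> 0" "z = eval_polyn P p / eval_polyn Q p"
      "S = Fract P' Q'" "eval_polyn Q' p \<noteq> 0" "w = eval_polyn P' p / eval_polyn Q' p"
    using assms by (auto simp: has_value_def)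
  then show ?thesis
    unfolding has_value_def
    by (intro exI[of _ "P * P'"] exI[of _ "Q * Q'"]) (simp add: eval_polyn_mult)
qed

lemma const_minus_1: "const (- 1) = (- 1 :: 'v::linorder ratfun)"
proof -
  have "const (- 1) + 1 = (0 :: 'v ratfun)"
    using const_add[of "- 1" 1, where 'v='v] by simp
  then show ?thesis by (simp add: eq_neg_iff_add_eq_0)
qed

lemma has_value_diff [intro]:
  assumes "has_value R p z" "has_value S p w"
  shows "has_value (R - S) p (z - w)"
proof -
  \<comment> \<open>Subtraction becomes addition of a constant multiple, so the rules for constants,
    sums and products suffice.\<close>
  have "has_value (R + const (- 1) * S) p (z + const (- 1) * w)"
    using assms by blast
  then show ?thesis by (simp add: const_minus_1)
qed

text \<open>Numerator and denominator change places; \<open>z \<noteq> 0\<close> says that the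
  numerator has a nonzero value.\<close>

lemma has_value_inverse [intro]:
  assumes "has_value R p z" "z \<noteq> 0"
  shows "has_value (inverse R) p (inverse z)"
proof -
  obtain P Q where *: "R = Fract P Q" "eval_polyn Q p \<noteq> 0" "z = eval_polyn P p / eval_polyn Q p"
    using assms by (auto simp: has_value_def)
  with assms show ?thesis
    unfolding has_value_def
    by (intro exI[of _ Q] exI[of _ P]) auto
qed

lemma has_value_divide [intro]:
  assumes "has_value R p z" "has_value S p w" "w \<noteq> 0"
  shows "has_value (R / S) p (z / w)"
  using assms by (auto simp: divide_inverse)

lemma has_value_prod [intro]:
  assumes "\<And>x. x \<in> X \<Longrightarrow> has_value (R x) p (z x)"
  shows "has_value (\<Prod>x\<in>X. R x) p (\<Prod>x\<in>X. z x)"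
  using assms by (induction X rule: infinite_finite_induct) auto

lemma has_value_q [intro]: "has_value q p q" and has_value_t [intro]: "has_value t p t"
  by (auto simp: q_def t_def)


section \<open>Shifts as field endomorphisms\<close>

definition shift_point :: "'n \<Rightarrow> 'n \<Rightarrow> 'n::linorder ratfun" where
  "shift_point i = (\<lambda>j. if j = i then q * var j else var j)"

section \<open>Scalars and the comparison of monomials\<close>

definition q0 :: scalar where "q0 = Fract [:[:0, 1:]:] 1"
definition t0 :: scalar where "t0 = Fract [:0, 1:] 1"

lemma q_eq_const: "q = const q0" and t_eq_const: "t = const t0"
  by (simp_all add: q_def t_def q0_def t0_def)

lemma q0_nonzero [simp]: "q0 \<noteq> 0" and t0_nonzero [simp]: "t0 \<noteq> 0"
  by (simp_all add: q0_def t0_def Zero_fract_def eq_fract)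

lemma Fract_power: "Fract a b ^ n = Fract (a ^ n) (b ^ n)"
  by (induction n) (auto simp: One_fract_def)

text \<open>Clearing fractions gives polynomials in t over C[q]; setting t to 0 kills the left side
  and leaves a power of q on the right.\<close>

lemma t0_q0_neq: "t0 * q0 ^ m \<noteq> q0 ^ n"
proof
  assume "t0 * q0 ^ m = q0 ^ n"
  then have *: "[:0, 1:] * [:[:0, 1::complex:]:] ^ m = [:[:0, 1:]:] ^ n"
    by (simp add: t0_def q0_def Fract_power eq_fract)
  have "poly ([:[:0, 1::complex:]:] ^ n) 0 \<noteq> 0"
    by (simp add: poly_power)
  then show False by (simp flip: *)
qed

lemma const_power: "const (a ^ n) = (const a ^ n :: 'v::linorder ratfun)"
  by (induction n) (auto simp: const_mult)

lemma var_nonzero [simp]: "var i \<noteq> (0 :: 'v::linorder ratfun)"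
proof -
  have "Poly_Mapping.single (Poly_Mapping.single i 1) (1::scalar) \<noteq> 0"
    by (metis lookup_single_eq lookup_zero zero_neq_one)
  then show ?thesis by (simp add: var_def Zero_fract_def eq_fract del: One_nat_def)
qed

lemma q_nonzero [simp]: "q \<noteq> (0 :: 'v::linorder ratfun)"
  and t_nonzero [simp]: "t \<noteq> (0 :: 'v::linorder ratfun)"
  by (simp_all add: q_eq_const t_eq_const)

text \<open>Both sides are single monomials, so their coefficients can be compared. Nonvanishing of
  differences such as \<open>t * var i - var j\<close> is reduced to the scalar field in this
  way.\<close>

lemma const_var_eqD:
  assumes "const a * var i = (const b * var j :: 'v::linorder ratfun)" "a \<noteq> 0"
  shows "i = j \<and> a = b"
proof -
  have "Poly_Mapping.single (Poly_Mapping.single i (1::nat)) a =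
      Poly_Mapping.single (Poly_Mapping.single j 1) b"
    using assms(1) by (simp add: const_def var_def mult_single eq_fract)
  then have "Poly_Mapping.lookup (Poly_Mapping.single (Poly_Mapping.single i (1::nat)) a) m =
      Poly_Mapping.lookup (Poly_Mapping.single (Poly_Mapping.single j 1) b) m" for m
    by simp
  from this[of "Poly_Mapping.single i 1"] have *: "Poly_Mapping.single i (1::nat) = Poly_Mapping.single j 1"
      "a = b"
    using assms(2) by (auto simp: lookup_single when_def split: if_splits)
  from arg_cong[OF *(1), of "\<lambda>m. Poly_Mapping.lookup m i"] have "i = j"
    by (auto simp: lookup_single when_def split: if_splits)
  with * show ?thesis by simp
qed

lemma eval_monom_shift_point:
  fixes m :: "'n::linorder \<Rightarrow>\<^sub>0 nat"
  shows "eval_monom m (shift_point i) =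
    const (q0 ^ Poly_Mapping.lookup m i) * eval_monom m var"
proof -
  \<comment> \<open>\<open>i\<close> may be missing from the support of \<open>m\<close>; inserting
    it only adds a factor with exponent 0.\<close>
  let ?K = "insert i (Poly_Mapping.keys m)"
  have 1: "(\<Prod>j\<in>?K. (if j = i then q else 1) ^ Poly_Mapping.lookup m j) =
      (q ^ Poly_Mapping.lookup m i :: 'n ratfun)"
    by (subst prod.insert_remove) (auto intro!: prod.neutral)
  have "eval_monom m (shift_point i) =
      (\<Prod>j\<in>?K. (if j = i then q else 1) ^ Poly_Mapping.lookup m j * var j ^ Poly_Mapping.lookup m j)"
    by (subst eval_monom_superset[of ?K]) (auto simp: shift_point_def power_mult_distrib intro!: prod.cong)
  also have "\<dots> = q ^ Poly_Mapping.lookup m i * eval_monom m var"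
    unfolding prod.distrib 1 by (subst eval_monom_superset[of ?K]) auto
  finally show ?thesis by (simp add: q_eq_const const_power)
qed

lemma eval_monom_var: "eval_monom m var = Fract (Poly_Mapping.single m 1) 1"
proof -
  have pw: "var i ^ k = Fract (Poly_Mapping.single (Poly_Mapping.single i k) 1) 1" for i :: 'a and k
    by (induction k) (auto simp: var_def mult_single single_add[symmetric] fract_collapse)
  have pr: "(\<Prod>i\<in>K. Fract (Poly_Mapping.single (f i) (1::scalar)) 1) =
      Fract (Poly_Mapping.single (\<Sum>i\<in>K. f i) 1) 1" for K and f :: "'a \<Rightarrow> 'a \<Rightarrow>\<^sub>0 nat"
    by (induction K rule: infinite_finite_induct) (auto simp: mult_single fract_collapse)
  have "(\<Sum>i\<in>Poly_Mapping.keys m. Poly_Mapping.single i (Poly_Mapping.lookup m i)) = m"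
    by (rule poly_mapping_eqI)
      (simp add: lookup_sum lookup_single when_def not_in_keys_iff_lookup_eq_zero sum.delta')
  then show ?thesis by (simp add: eval_monom_def pw pr)
qed

text \<open>Shifting multiplies each coefficient by a power of \<open>q\<close>, so it kills no polynomial.\<close>

lemma eval_polyn_shift_point_nonzero:
  fixes P :: "'n::linorder polyn"
  assumes "P \<noteq> 0"
  shows "eval_polyn P (shift_point i) \<noteq> 0"
proof -
  define P' where "P' = (\<Sum>m\<in>Poly_Mapping.keys P.
    Poly_Mapping.single m (Poly_Mapping.lookup P m * q0 ^ Poly_Mapping.lookup m i))"
  have sum: "(\<Sum>m\<in>K. Fract (f m) 1) = Fract (\<Sum>m\<in>K. f m) 1" for K and f :: "('n \<Rightarrow>\<^sub>0 nat) \<Rightarrow> 'n polyn"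
    by (induction K rule: infinite_finite_induct) (auto simp: Zero_fract_def)
  have "eval_polyn P (shift_point i) = Fract P' 1"
    unfolding eval_polyn_def eval_monom_def[symmetric] P'_def
    by (simp add: eval_monom_shift_point eval_monom_var flip: sum)
      (simp add: const_def mult_single)
  moreover have "P' \<noteq> 0"
  proof
    assume "P' = 0"
    obtain m where m: "Poly_Mapping.lookup P m \<noteq> 0"
      using assms by (metis lookup_zero poly_mapping_eqI)
    have "Poly_Mapping.lookup P' m = Poly_Mapping.lookup P m * q0 ^ Poly_Mapping.lookup m i"
      using m by (simp add: P'_def lookup_sum lookup_single when_def in_keys_iff sum.delta')
    with \<open>P' = 0\<close> m show False by simp
  qed
  ultimately show ?thesis by (simp add: Zero_fract_def eq_fract)
qed

text \<open>No nonzero denominator is killed at \<open>shift_point i\<close>, so every rational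
  function is regular there and the laws for shifts need no regularity assumption.\<close>

lemma has_value_shift: "has_value f (shift_point i) (shift i f)"
proof -
  obtain P Q where "f = Fract P Q" "Q \<noteq> 0" by (cases f)
  then have "has_value f (shift_point i) (eval_polyn P (shift_point i) / eval_polyn Q (shift_point i))"
    using eval_polyn_shift_point_nonzero[of Q i] by (auto simp: has_value_def)
  then show ?thesis
    using eval_ratfun_eqI by (fastforce simp: shift_def shift_point_def)
qed

section \<open>Shifts and the field operations\<close>

lemma shift_eqI: "has_value f (shift_point i) z \<Longrightarrow> shift i f = z"
  using has_value_shift has_value_unique by blast

lemma shift_const [simp]: "shift i (const c) = const c"
  by (rule shift_eqI) auto

lemma shift_q [simp]: "shift i q = q" and shift_t [simp]: "shift i t = t"
  by (simp_all add: q_eq_const t_eq_const)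

lemma shift_0 [simp]: "shift i 0 = 0" and shift_1 [simp]: "shift i 1 = 1"
  using shift_const[of i 0] shift_const[of i 1] by simp_all

lemma shift_var: "shift i (var j) = (if j = i then q * var j else var j)"
proof -
  have "shift i (var j) = shift_point i j" by (rule shift_eqI) (rule has_value_var)
  then show ?thesis by (simp add: shift_point_def)
qed

lemma shift_add: "shift i (f + g) = shift i f + shift i g"
  and shift_diff: "shift i (f - g) = shift i f - shift i g"
  and shift_mult: "shift i (f * g) = shift i f * shift i g"
  by (rule shift_eqI; blast intro: has_value_shift)+

text \<open>A nonzero \<open>f\<close> is invertible and \<open>shift i\<close> is multiplicative
  with \<open>shift i 1 = 1\<close>, so the image of \<open>f\<close> is invertible too.\<close>

lemma shift_eq_0_iff [simp]: "shift i f = 0 \<longleftrightarrow> f = 0"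
  by (metis mult.commute mult_zero_left right_inverse shift_0 shift_1 shift_mult zero_neq_one)

lemma shift_inverse: "shift i (inverse f) = inverse (shift i f)"
  by (cases "f = 0") (auto intro!: shift_eqI has_value_shift)

lemma shift_divide: "shift i (f / g) = shift i f / shift i g"
  by (simp add: divide_inverse shift_mult shift_inverse)

lemma shift_power: "shift i (f ^ n) = shift i f ^ n"
  by (induction n) (auto simp: shift_mult)

lemma shift_powi: "shift i (f powi n) = shift i f powi n"
  by (auto simp: power_int_def shift_power shift_inverse)

lemma shift_sum: "shift i (\<Sum>x\<in>X. f x) = (\<Sum>x\<in>X. shift i (f x))"
  by (induction X rule: infinite_finite_induct) (auto simp: shift_add)

lemma shift_prod: "shift i (\<Prod>x\<in>X. f x) = (\<Prod>x\<in>X. shift i (f x))"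
  by (induction X rule: infinite_finite_induct) (auto simp: shift_mult)

lemmas shift_hom = shift_add shift_diff shift_mult shift_divide shift_powi shift_sum shift_prod

text \<open>Both compositions respect the field operations and fix the scalars. They agree on the
  variables, hence on polynomials, hence on quotients of polynomials.\<close>

lemma shift_commute: "shift i (shift j f) = shift j (shift i f)"
proof -
  have P: "shift i (shift j (eval_polyn P var)) = shift j (shift i (eval_polyn P var))" for P :: "'a polyn"
  proof -
    have "shift i (shift j (var k)) = shift j (shift i (var k))" for k
      by (simp add: shift_var shift_mult)
    then show ?thesis
      by (simp add: eval_polyn_def shift_sum shift_mult shift_prod shift_power)
  qed
  have var: "eval_polyn P var = Fract P 1" for P :: "'a polyn"
  proof -
    have "(\<Sum>m\<in>K. Fract (g m) 1) = Fract (\<Sum>m\<in>K. g m) 1" for K and g :: "('a \<Rightarrow>\<^sub>0 nat) \<Rightarrow> 'a polyn"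
      by (induction K rule: infinite_finite_induct) (auto simp: Zero_fract_def)
    then have "(\<Sum>m\<in>Poly_Mapping.keys P. Fract (Poly_Mapping.single m (Poly_Mapping.lookup P m)) 1) =
        Fract P 1"
      by (simp add: polyn_as_sum)
    then show ?thesis
      unfolding eval_polyn_def eval_monom_def[symmetric]
      by (simp add: eval_monom_var const_def mult_single)
  qed
  obtain P Q where f: "f = Fract P Q" by (cases f)
  then have "f = eval_polyn P var / eval_polyn Q var" by (simp add: var)
  then show ?thesis by (simp add: shift_divide P)
qed

lemma shifts_Nil [simp]: "shifts [] f = f"
  and shifts_Cons [simp]: "shifts (i # is) f = shift i (shifts is f)"
  by (simp_all add: shifts_def)

text \<open>Since shifts commute, sorting the word does not change the operator. All orderings of a
  set of indices therefore carry the same product of shifts.\<close>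

lemma shifts_mset_cong: "mset is = mset js \<Longrightarrow> shifts is f = shifts js f"
proof -
  have ins: "shifts (insort i is) f = shift i (shifts is f)" for i :: 'a and "is"
    by (induction "is") (auto simp: shift_commute)
  have "shifts (sort is) f = shifts is f" for "is" :: "'a list"
    by (induction "is") (auto simp: ins)
  then show "mset is = mset js \<Longrightarrow> ?thesis"
    by (metis properties_for_sort sorted_sort sort_key_def mset_sort)
qed


section \<open>Linear independence of products of delta functions\<close>

text \<open>Artin's argument for the independence of characters: two instances of the relation are
  combined to eliminate one character, using a coordinate in which it differs from the one under
  study.\<close>

lemma monomials_independent:
  fixes g :: "'a::field list \<Rightarrow> 'a"
  assumes "finite Y" "\<And>y. y \<in> Y \<Longrightarrow> length y = \<alpha> \<and> 0 \<notin> set y"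
    and "\<And>a. length a = \<alpha> \<Longrightarrow> (\<Sum>y\<in>Y. g y * (\<Prod>k<\<alpha>. (y ! k) powi (a ! k))) = 0"
    and "y \<in> Y"
  shows "g y = 0"
  using assms
proof (induction Y arbitrary: g y rule: finite_induct)
  case empty
  then show ?case by simp
next
  case (insert z Y)
  let ?\<chi> = "\<lambda>y a. \<Prod>k<\<alpha>. (y ! k) powi (a ! k)"
  have Y: "g y = 0" if "y \<in> Y" for y
  proof -
    have "length y = length z" "y \<noteq> z"
      using insert.prems(1) insert.hyps(2) that by auto
    then obtain k where k: "k < \<alpha>" "y ! k \<noteq> z ! k"
      using insert.prems(1)[of z] by (auto simp: list_eq_iff_nth_eq)
    have "g y * (y ! k - z ! k) = 0"
    proof (rule insert.IH[of "\<lambda>y. g y * (y ! k - z ! k)"])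
      fix a :: "int list" assume a: "length a = \<alpha>"
      let ?b = "a[k := a ! k + 1]"
      have \<chi>: "?\<chi> w ?b = w ! k * ?\<chi> w a" if "w \<in> insert z Y" for w
      proof -
        have "w ! k \<noteq> 0"
          using insert.prems(1)[OF that] k(1) by (metis nth_mem)
        then show ?thesis
          using a k(1) by (simp add: prod.remove[of "{..<\<alpha>}" k] power_int_add_1')
      qed
      \<comment> \<open>Passing from \<open>a\<close> to \<open>?b\<close> multiplies the character
        of \<open>w\<close> by \<open>w ! k\<close>; subtracting \<open>z ! k\<close> times the
        relation at \<open>a\<close> cancels the term of \<open>z\<close>.\<close>
      have "0 = (\<Sum>w\<in>insert z Y. g w * ?\<chi> w ?b) - z ! k * (\<Sum>w\<in>insert z Y. g w * ?\<chi> w a)"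
        using insert.prems(2)[of a] insert.prems(2)[of ?b] a by simp
      also have "\<dots> = (\<Sum>w\<in>insert z Y. g w * (w ! k - z ! k) * ?\<chi> w a)"
        unfolding sum_distrib_left sum_subtractf[symmetric]
        by (intro sum.cong refl, subst \<chi>) (auto simp: algebra_simps)
      also have "\<dots> = (\<Sum>w\<in>Y. g w * (w ! k - z ! k) * ?\<chi> w a)"
        using insert.hyps by simp
      finally show "(\<Sum>w\<in>Y. g w * (w ! k - z ! k) * ?\<chi> w a) = 0"
        by simp
    qed (use insert.prems(1) that in auto)
    with k show ?thesis by simp
  qed
  \<comment> \<open>At exponent zero every character equals 1, and only \<open>g z\<close> is left
    of the relation.\<close>
  have "g z = 0"
    using insert.prems(2)[of "replicate \<alpha> 0"] insert.hyps Y by simp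
  with Y insert.prems(3) show ?case by auto
qed

section \<open>Independence of the chosen expansion into delta terms\<close>

lemma delta_term_nonzero:
  assumes "delta_term \<alpha> (c, y, js)"
  shows "length y = \<alpha> \<and> 0 \<notin> set y"
proof -
  have "z \<noteq> 0" if "z \<in> set y" for z
    using assms that by (force simp: delta_term_def)
  then show ?thesis using assms by (auto simp: delta_term_def)
qed

lemma current_eqI:
  assumes "\<And>a f. length a = \<alpha> \<Longrightarrow> f \<in> symmetric_ratfuns \<Longrightarrow> A a f = B a f"
  shows "current \<alpha> A = current \<alpha> B"
  unfolding current_def by (intro restrict_ext) (auto intro!: restrict_ext assms)

lemma current_eqD:
  assumes "current \<alpha> A = current \<alpha> B" "length a = \<alpha>" "f \<in> symmetric_ratfuns"
  shows "A a f = B a f"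
  using fun_cong[OF fun_cong[OF assms(1), of a], of f] assms(2,3) by (simp add: current_def)

text \<open>Several terms may share a support, so the single coefficients are not determined by the
  current; this grouped one, applied to \<open>f\<close>, is.\<close>

definition support_coeff :: "'n::linorder delta_term list \<Rightarrow> 'n ratfun \<Rightarrow> 'n ratfun list \<Rightarrow> 'n ratfun" where
  "support_coeff ts f y = (\<Sum>(c, y', js)\<leftarrow>ts. if y' = y then c * shifts js f else 0)"

text \<open>The factors \<open>w\<close> and \<open>\<chi>\<close> depend on the support only and
  can be pulled out of each group. The case \<open>w = 1\<close> describes a delta sum, general
  \<open>w\<close> its multiple by a rational function.\<close>

lemma sum_list_by_support:
  assumes "finite Y" "(\<lambda>(c, y, js). y) ` set ts \<subseteq> Y"
  shows "(\<Sum>(c, y, js)\<leftarrow>ts. w y * c * \<chi> y * shifts js f) =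
    (\<Sum>y\<in>Y. w y * support_coeff ts f y * \<chi> y)"
  using assms(2)
proof (induction ts)
  case Nil
  then show ?case by (simp add: support_coeff_def)
next
  case (Cons u ts)
  obtain c y js where u: "u = (c, y, js)" by (cases u)
  have "(\<Sum>y'\<in>Y. w y' * support_coeff (u # ts) f y' * \<chi> y') =
      (\<Sum>y'\<in>Y. (if y = y' then w y * c * \<chi> y * shifts js f else 0) + w y' * support_coeff ts f y' * \<chi> y')"
    by (intro sum.cong) (auto simp: u support_coeff_def algebra_simps)
  also have "\<dots> = w y * c * \<chi> y * shifts js f + (\<Sum>y\<in>Y. w y * support_coeff ts f y * \<chi> y)"
    using Cons.prems assms(1) by (simp add: u sum.distrib)
  finally show ?case using Cons by (simp add: u)
qed

text \<open>Equal delta sums have equal grouped coefficients, by independence of the characters, and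
  the multiplied sums depend on the terms only through these coefficients.\<close>

lemma delta_sum_times_unique:
  fixes ts ts' :: "'n::linorder delta_term list"
  assumes ts: "\<forall>u\<in>set ts. delta_term \<alpha> u" and ts': "\<forall>u\<in>set ts'. delta_term \<alpha> u"
    and eq: "delta_sum \<alpha> ts = delta_sum \<alpha> ts'"
  shows "delta_sum \<alpha> (map (\<lambda>(c, y, js). (w y * c, y, js)) ts) =
    delta_sum \<alpha> (map (\<lambda>(c, y, js). (w y * c, y, js)) ts')"
proof -
  let ?\<chi> = "\<lambda>a y. \<Prod>k<\<alpha>. (y ! k) powi (a ! k)"
  define Y where "Y = (\<lambda>(c, y, js). y) ` set (ts @ ts')"
  have Y: "finite Y" "(\<lambda>(c, y, js). y) ` set ts \<subseteq> Y" "(\<lambda>(c, y, js). y) ` set ts' \<subseteq> Y"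
    by (simp_all add: Y_def image_Un)
  have Y_nz: "length y = \<alpha> \<and> 0 \<notin> set y" if "y \<in> Y" for y
    using that ts ts' delta_term_nonzero by (fastforce simp: Y_def)
  have coeff: "support_coeff ts f y = support_coeff ts' f y"
    if f: "f \<in> symmetric_ratfuns" and y: "y \<in> Y" for f y
  proof -
    have "support_coeff ts f y - support_coeff ts' f y = 0"
    proof (rule monomials_independent[OF Y(1) Y_nz _ y])
      fix a :: "int list" assume a: "length a = \<alpha>"
      \<comment> \<open>The factor 1 fits the sums to the grouping lemma with constant
        weight.\<close>
      have "(\<Sum>(c, y, js)\<leftarrow>ts. 1 * c * ?\<chi> a y * shifts js f) = (\<Sum>(c, y, js)\<leftarrow>ts'. 1 * c * ?\<chi> a y * shifts js f)"
        using current_eqD[OF eq[unfolded delta_sum_def] a f] by simp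
      then have "(\<Sum>y\<in>Y. 1 * support_coeff ts f y * ?\<chi> a y) = (\<Sum>y\<in>Y. 1 * support_coeff ts' f y * ?\<chi> a y)"
        using sum_list_by_support[OF Y(1,2), of "\<lambda>_. 1" "?\<chi> a" f]
          sum_list_by_support[OF Y(1,3), of "\<lambda>_. 1" "?\<chi> a" f] by simp
      then show "(\<Sum>y\<in>Y. (support_coeff ts f y - support_coeff ts' f y) * ?\<chi> a y) = 0"
        by (simp add: left_diff_distrib sum_subtractf)
    qed
    then show ?thesis by simp
  qed
  show ?thesis
    unfolding delta_sum_def
  proof (rule current_eqI)
    fix a :: "int list" and f :: "'n ratfun"
    assume f: "f \<in> symmetric_ratfuns"
    have map: "(\<Sum>(c, y, js)\<leftarrow>map (\<lambda>(c, y, js). (w y * c, y, js)) us. c * ?\<chi> a y * shifts js f) =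
        (\<Sum>(c, y, js)\<leftarrow>us. w y * c * ?\<chi> a y * shifts js f)" for us :: "'n delta_term list"
      by (simp add: o_def case_prod_unfold)
    show "(\<Sum>(c, y, js)\<leftarrow>map (\<lambda>(c, y, js). (w y * c, y, js)) ts. c * ?\<chi> a y * shifts js f) =
        (\<Sum>(c, y, js)\<leftarrow>map (\<lambda>(c, y, js). (w y * c, y, js)) ts'. c * ?\<chi> a y * shifts js f)"
      unfolding map sum_list_by_support[OF Y(1,2)] sum_list_by_support[OF Y(1,3)]
      by (intro sum.cong refl) (simp add: coeff[OF f])
  qed
qed

text \<open>Resolves the definite description: \<open>ts\<close> itself is a witness, and any other
  admissible expansion gives the same result.\<close>

lemma ratfun_times_delta_sum:
  assumes "\<And>c y js. (c, y, js) \<in> set ts \<Longrightarrow> delta_term \<alpha> (c, y, js) \<and> regular_at R (inverse_point y)"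
  shows "ratfun_times_current \<alpha> R (delta_sum \<alpha> ts) =
    delta_sum \<alpha> (map (\<lambda>(c, y, js). (eval_ratfun R (inverse_point y) * c, y, js)) ts)"
  unfolding ratfun_times_current_def
proof (rule the_equality)
  show "\<exists>us. (\<forall>(c, y, js)\<in>set us. delta_term \<alpha> (c, y, js) \<and> regular_at R (inverse_point y)) \<and>
      delta_sum \<alpha> ts = delta_sum \<alpha> us \<and>
      delta_sum \<alpha> (map (\<lambda>(c, y, js). (eval_ratfun R (inverse_point y) * c, y, js)) ts) =
      delta_sum \<alpha> (map (\<lambda>(c, y, js). (eval_ratfun R (inverse_point y) * c, y, js)) us)"
    using assms by (intro exI[of _ ts]) auto
next
  fix D'
  assume "\<exists>us. (\<forall>(c, y, js)\<in>set us. delta_term \<alpha> (c, y, js) \<and> regular_at R (inverse_point y)) \<and>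
      delta_sum \<alpha> ts = delta_sum \<alpha> us \<and>
      D' = delta_sum \<alpha> (map (\<lambda>(c, y, js). (eval_ratfun R (inverse_point y) * c, y, js)) us)"
  then obtain us where us: "\<forall>(c, y, js)\<in>set us. delta_term \<alpha> (c, y, js) \<and> regular_at R (inverse_point y)"
      "delta_sum \<alpha> us = delta_sum \<alpha> ts"
      "D' = delta_sum \<alpha> (map (\<lambda>(c, y, js). (eval_ratfun R (inverse_point y) * c, y, js)) us)"
    by auto
  show "D' = delta_sum \<alpha> (map (\<lambda>(c, y, js). (eval_ratfun R (inverse_point y) * c, y, js)) ts)"
    unfolding us(3) by (rule delta_sum_times_unique) (use us assms in auto)
qed

section \<open>The generalized Schur function as a sum over orderings\<close>

text \<open>If the last index is not moved, its factors are only permuted. If it is, the two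
  products over \<open>i < a\<close> change places and the factor \<open>x a - x (Suc a)\<close>
  alone changes sign.\<close>

lemma vandermonde_adjacent_transpose:
  fixes x :: "nat \<Rightarrow> 'a::comm_ring_1"
  assumes "Suc a < n"
  shows "(\<Prod>j<n. \<Prod>i<j. x (transpose a (Suc a) i) - x (transpose a (Suc a) j)) =
    - (\<Prod>j<n. \<Prod>i<j. x i - x j)"
  using assms
proof (induction n)
  case (Suc n)
  let ?\<tau> = "transpose a (Suc a)"
  show ?case
  proof (cases "Suc a < n")
    case True
    have "?\<tau> permutes {..<n}"
      by (rule permutes_swap_id) (use True in auto)
    then have "(\<Prod>i<n. x (?\<tau> i) - x n) = (\<Prod>i<n. x i - x n)"
      using prod.permute[of ?\<tau> "{..<n}" "\<lambda>i. x i - x n"] by (simp add: o_def)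
    moreover have "?\<tau> n = n" using True by (simp add: transpose_def)
    ultimately show ?thesis using Suc.IH[OF True] by simp
  next
    case False
    then have n: "n = Suc a" using Suc.prems by simp
    have \<tau>: "?\<tau> i = i" if "i < a" for i using that by (simp add: transpose_def)
    have "(\<Prod>j<a. \<Prod>i<j. x (?\<tau> i) - x (?\<tau> j)) = (\<Prod>j<a. \<Prod>i<j. x i - x j)"
      by (intro prod.cong refl) (simp add: \<tau>)
    moreover have "(\<Prod>i<a. x (?\<tau> i) - z) = (\<Prod>i<a. x i - z)" for z
      by (intro prod.cong refl) (simp add: \<tau>)
    ultimately show ?thesis by (simp add: n algebra_simps)
  qed
qed simp

text \<open>A transposition of distant indices is a closer one conjugated by an adjacent one; the
  three sign changes leave one minus sign.\<close>

lemma vandermonde_transpose: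
  fixes x :: "nat \<Rightarrow> 'a::comm_ring_1"
  assumes "a < b" "b < n"
  shows "(\<Prod>j<n. \<Prod>i<j. x (transpose a b i) - x (transpose a b j)) = - (\<Prod>j<n. \<Prod>i<j. x i - x j)"
  using assms
proof (induction "b - a" arbitrary: a x)
  case (Suc d)
  show ?case
  proof (cases "b = Suc a")
    case True
    then show ?thesis using vandermonde_adjacent_transpose Suc.prems by blast
  next
    case False
    let ?\<tau> = "transpose a (Suc a)"
    have "transpose a b = ?\<tau> \<circ> transpose (Suc a) b \<circ> ?\<tau>"
      using transpose_comp_triple[of a b "Suc a"] False Suc.prems by simp
    then have eq: "transpose a b i = ?\<tau> (transpose (Suc a) b (?\<tau> i))" for i by simp
    show ?thesis
      unfolding eq
      using vandermonde_adjacent_transpose[of a n "\<lambda>i. x (?\<tau> (transpose (Suc a) b i))"]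
        Suc.hyps(1)[of "Suc a" "\<lambda>i. x (?\<tau> i)"] vandermonde_adjacent_transpose[of a n x]
        Suc.hyps(2) Suc.prems False
      by simp
  qed
qed simp

text \<open>Each transposition contributes one sign. The family \<open>x\<close> is generalized
  because the induction hypothesis is applied to the transposed family.\<close>

lemma vandermonde_permutes:
  fixes x :: "nat \<Rightarrow> 'a::comm_ring_1"
  assumes "p permutes {..<n}"
  shows "(\<Prod>j<n. \<Prod>i<j. x (p i) - x (p j)) = of_int (sign p) * (\<Prod>j<n. \<Prod>i<j. x i - x j)"
proof -
  have "finite {..<n}" by simp
  with assms show ?thesis
  proof (induction arbitrary: x rule: permutes_induct)
    case id
    then show ?case by simp
  next
    case (swap a b p)
    have tr: "(\<Prod>j<n. \<Prod>i<j. x (transpose a b i) - x (transpose a b j)) = - (\<Prod>j<n. \<Prod>i<j. x i - x j)"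
      using vandermonde_transpose[of a b n x] vandermonde_transpose[of b a n x] swap.hyps
      by (cases "a < b") (auto simp: transpose_commute)
    have "permutation p" using swap.hyps permutation_permutes by blast
    then have sgn: "sign (transpose a b \<circ> p) = - sign p"
      using swap.hyps by (simp add: sign_compose permutation_swap_id sign_swap_id)
    then show ?case
      using swap.IH[of "\<lambda>i. x (transpose a b i)"] sgn by (simp add: tr o_def)
  qed
qed

text \<open>Recursion on the list matches the recursive expansion of a product of operators;
  \<open>pair_prod_nth\<close> links it to products over pairs of positions.\<close>

fun pair_prod :: "('a \<Rightarrow> 'a \<Rightarrow> 'b::comm_monoid_mult) \<Rightarrow> 'a list \<Rightarrow> 'b" where
  "pair_prod f [] = 1"
| "pair_prod f (x # xs) = (\<Prod>y\<leftarrow>xs. f x y) * pair_prod f xs"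

lemma pair_prod_nth: "pair_prod f xs = (\<Prod>j<length xs. \<Prod>i<j. f (xs ! i) (xs ! j))"
proof (induction xs)
  case (Cons x xs)
  have "(\<Prod>y\<leftarrow>xs. f x y) = (\<Prod>j<length xs. f x (xs ! j))"
    by (simp add: prod.list_conv_set_nth atLeast0LessThan)
  with Cons show ?case
    by (simp add: prod.lessThan_Suc_shift prod.distrib del: prod.lessThan_Suc)
qed simp

text \<open>Entry \<open>k\<close> comes first in its pairs with the
  \<open>length xs - 1 - k\<close> later entries. This yields the staircase exponents of the Schur
  determinant.\<close>

lemma pair_prod_fst: "pair_prod (\<lambda>x y. x) xs = (\<Prod>k<length xs. xs ! k ^ (length xs - 1 - k))"
proof (induction xs)
  case (Cons x xs)
  then show ?case
    by (simp add: prod.lessThan_Suc_shift map_replicate_const del: prod.lessThan_Suc)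
qed simp

text \<open>Each permutation in the Leibniz expansion gives one ordering: its sign is absorbed by
  the permuted Vandermonde product, and the numerators \<open>x\<close> supply the staircase
  powers.\<close>

lemma gen_schur_eq_sum_orderings:
  fixes xs :: "'a::field list"
  assumes xs: "distinct xs" "0 \<notin> set xs" "length xs = length a"
  shows "gen_schur a xs = (\<Sum>ys | mset ys = mset xs.
    pair_prod (\<lambda>x y. x / (x - y)) ys * (\<Prod>k<length a. (ys ! k) powi (a ! k)))"
proof -
  define \<alpha> where "\<alpha> = length a"
  define \<Delta> where "\<Delta> = (\<Prod>j<\<alpha>. \<Prod>i<j. xs ! i - xs ! j)"
  have len: "length xs = \<alpha>" using xs by (simp add: \<alpha>_def)
  have \<Delta>: "\<Delta> \<noteq> 0"
    using xs(1) len by (auto simp: \<Delta>_def nth_eq_iff_index_eq)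
  \<comment> \<open>Since \<open>xs\<close> is distinct, each ordering arises from exactly one
    permutation.\<close>
  have bij: "bij_betw (\<lambda>p. permute_list p xs) {p. p permutes {..<\<alpha>}} {ys. mset ys = mset xs}"
    unfolding bij_betw_def
  proof
    show "inj_on (\<lambda>p. permute_list p xs) {p. p permutes {..<\<alpha>}}"
    proof (rule inj_onI, clarsimp)
      fix p p' assume p: "p permutes {..<\<alpha>}" "p' permutes {..<\<alpha>}" "permute_list p xs = permute_list p' xs"
      have "p i = p' i" for i
      proof (cases "i < \<alpha>")
        case True
        then have "xs ! p i = xs ! p' i"
          using p len by (metis permute_list_nth)
        moreover have "p i < \<alpha>" "p' i < \<alpha>"
          using p(1,2) True by (metis lessThan_iff permutes_in_image)+
        ultimately show ?thesis
          using xs(1) len by (simp add: nth_eq_iff_index_eq)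
      qed (use p in \<open>simp add: permutes_def\<close>)
      then show "p = p'" by blast
    qed
    show "(\<lambda>p. permute_list p xs) ` {p. p permutes {..<\<alpha>}} = {ys. mset ys = mset xs}"
      using len by (force elim!: mset_eq_permutation)
  qed
  have summand: "pair_prod (\<lambda>x y. x / (x - y)) (permute_list p xs) *
        (\<Prod>k<\<alpha>. (permute_list p xs ! k) powi (a ! k)) =
      of_int (sign p) * (\<Prod>k<\<alpha>. (xs ! p k) powi (a ! k + int \<alpha> - 1 - int k)) / \<Delta>"
    if p: "p permutes {..<\<alpha>}" for p
  proof -
    have nth: "permute_list p xs ! k = xs ! p k" if "k < \<alpha>" for k
      using p that len by (simp add: permute_list_nth)
    have nz: "xs ! p k \<noteq> 0" if "k < \<alpha>" for k
      using p that xs len by (metis lessThan_iff nth_mem permutes_in_image)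
    have "pair_prod (\<lambda>x y. x / (x - y)) (permute_list p xs) =
        pair_prod (\<lambda>x y. x) (permute_list p xs) / (\<Prod>j<\<alpha>. \<Prod>i<j. xs ! p i - xs ! p j)"
      unfolding pair_prod_nth by (simp add: len nth prod_dividef)
    also have "\<dots> = (\<Prod>k<\<alpha>. (xs ! p k) ^ (\<alpha> - 1 - k)) / (of_int (sign p) * \<Delta>)"
      unfolding pair_prod_fst vandermonde_permutes[OF p, of "\<lambda>i. xs ! i"] \<Delta>_def
      by (simp add: len nth)
    \<comment> \<open>A sign is its own reciprocal, so it moves from the denominator to the
      numerator.\<close>
    also have "\<dots> = of_int (sign p) * (\<Prod>k<\<alpha>. (xs ! p k) ^ (\<alpha> - 1 - k)) / \<Delta>"
      by (cases p rule: sign_cases) simp_all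
    finally have "pair_prod (\<lambda>x y. x / (x - y)) (permute_list p xs) *
        (\<Prod>k<\<alpha>. (permute_list p xs ! k) powi (a ! k)) =
      of_int (sign p) * (\<Prod>k<\<alpha>. (xs ! p k) ^ (\<alpha> - 1 - k) * (xs ! p k) powi (a ! k)) / \<Delta>"
      by (simp add: nth prod.distrib)
    also have "(\<Prod>k<\<alpha>. (xs ! p k) ^ (\<alpha> - 1 - k) * (xs ! p k) powi (a ! k)) =
        (\<Prod>k<\<alpha>. (xs ! p k) powi (a ! k + int \<alpha> - 1 - int k))"
    proof (intro prod.cong refl)
      fix k assume k: "k \<in> {..<\<alpha>}"
      \<comment> \<open>The bound \<open>k < \<alpha>\<close> keeps the subtraction of natural
        numbers from being truncated.\<close>
      then have e: "a ! k + int \<alpha> - 1 - int k = int (\<alpha> - 1 - k) + a ! k" by auto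
      then show "(xs ! p k) ^ (\<alpha> - 1 - k) * (xs ! p k) powi (a ! k) =
          (xs ! p k) powi (a ! k + int \<alpha> - 1 - int k)"
        unfolding e using nz k by (subst power_int_add) (simp_all del: of_nat_diff)
    qed
    finally show ?thesis .
  qed
  let ?M = "mat \<alpha> \<alpha> (\<lambda>(i, j). (xs ! i) powi (a ! j + int \<alpha> - 1 - int j))"
  have "gen_schur a xs = det ?M / \<Delta>"
    by (simp add: gen_schur_def Let_def \<alpha>_def \<Delta>_def)
  \<comment> \<open>The column form puts the permutation on the row index, hence on the variables
    and not on the exponents.\<close>
  also have "det ?M = (\<Sum>p | p permutes {0..<\<alpha>}. signof p * (\<Prod>j<\<alpha>. ?M $$ (p j, j)))"
    by (rule det_col) simp
  also have "\<dots> = (\<Sum>p | p permutes {..<\<alpha>}. of_int (sign p) * (\<Prod>k<\<alpha>. (xs ! p k) powi (a ! k + int \<alpha> - 1 - int k)))"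
  proof (rule sum.cong)
    fix p assume "p \<in> {p. p permutes {..<\<alpha>}}"
    then have "p k < \<alpha>" if "k < \<alpha>" for k using that by (metis lessThan_iff mem_Collect_eq permutes_in_image)
    then show "signof p * (\<Prod>j<\<alpha>. ?M $$ (p j, j)) =
        of_int (sign p) * (\<Prod>k<\<alpha>. (xs ! p k) powi (a ! k + int \<alpha> - 1 - int k))"
      by simp
  qed (simp add: atLeast0LessThan)
  finally show ?thesis
    unfolding sum.reindex_bij_betw[OF bij, symmetric] \<alpha>_def[symmetric]
    by (simp add: sum_divide_distrib summand)
qed


section \<open>Expansion of the product of currents\<close>

definition weight :: "'n \<Rightarrow> 'n \<Rightarrow> 'n::linorder ratfun" where
  "weight i j = (t * var i - var j) / (var i - var j)"

text \<open>
  The term of the product indexed by \<open>i\<^sub>1, \<dots>, i\<^sub>\<alpha>\<close> has the support \<open>y\<close> in which \<open>y\<^sub>k\<close> is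
  \<open>x\<close> of index \<open>i\<^sub>k\<close>, multiplied by \<open>q\<close> once for each earlier occurrence of \<open>i\<^sub>k\<close>.
\<close>

fun word_coeff :: "'n list \<Rightarrow> 'n::{finite,linorder} ratfun" where
  "word_coeff [] = 1"
| "word_coeff (i # is) = (\<Prod>j\<in>- {i}. weight i j) * shift i (word_coeff is)"

fun word_support :: "'n::linorder list \<Rightarrow> 'n ratfun list" where
  "word_support [] = []"
| "word_support (i # is) = var i # map (shift i) (word_support is)"

lemma length_word_support [simp]: "length (word_support is) = length is"
  by (induction "is") auto

lemma gen_schur_single: "gen_schur [n] [x] = x powi n"
proof -
  have "det (mat 1 1 (\<lambda>(i, j). [x] ! i powi ([n] ! j + int 1 - 1 - int j))) = x powi n"
    by (subst det_single) simp_all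
  then show ?thesis by (simp add: gen_schur_def Let_def)
qed

lemma macdonald_single:
  "macdonald [n] f = (\<Sum>i\<in>UNIV. var i powi n * (\<Prod>j\<in>- {i}. weight i j) * shift i f)"
proof -
  have "{I :: 'a set. card I = length [n]} = (\<lambda>i. {i}) ` UNIV"
    by (auto simp: card_1_singleton_iff)
  then show ?thesis
    unfolding macdonald_def
    by (simp add: sum.reindex gen_schur_single weight_def)
qed

lemma lists_length_Suc: "{is. length is = Suc n} = (\<lambda>(i, is). i # is) ` (UNIV \<times> {is. length is = n})"
  by (force simp: length_Suc_conv)

text \<open>The leftmost operator acts last: its shift passes through the expansion of the tail,
  shifting both coefficient and support, as in the recursions of \<open>word_coeff\<close> and
  \<open>word_support\<close>.\<close>

lemma macdonald_composition:
  fixes f :: "'n::{finite,linorder} ratfun"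
  shows "foldr (\<lambda>n F. macdonald [n] \<circ> F) a id f =
    (\<Sum>is | length is = length a.
      word_coeff is * (\<Prod>k<length a. (word_support is ! k) powi (a ! k)) * shifts is f)"
proof (induction a)
  case (Cons n a)
  have inj: "inj_on (\<lambda>(i, is). i # is) (UNIV \<times> {is :: 'n list. length is = length a})"
    by (auto simp: inj_on_def)
  have chi: "(\<Prod>k<length a. shift i (word_support is ! k) powi (a ! k)) =
      (\<Prod>k<length a. (word_support (i # is) ! Suc k) powi (a ! k))"
    if "length is = length a" for i :: 'n and "is"
    using that by (intro prod.cong) auto
  have "foldr (\<lambda>n F. macdonald [n] \<circ> F) (n # a) id f =
      (\<Sum>i\<in>UNIV. \<Sum>is | length is = length a. var i powi n * (\<Prod>j\<in>- {i}. weight i j) *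
        (shift i (word_coeff is) * (\<Prod>k<length a. shift i (word_support is ! k) powi (a ! k)) *
          shift i (shifts is f)))"
    by (simp add: Cons macdonald_single shift_hom sum_distrib_left)
  also have "\<dots> = (\<Sum>i\<in>UNIV. \<Sum>is | length is = length a. word_coeff (i # is) *
      (\<Prod>k<length (n # a). (word_support (i # is) ! k) powi ((n # a) ! k)) * shifts (i # is) f)"
  proof (intro sum.cong refl)
    fix i :: 'n and "is" :: "'n list" assume "is \<in> {is. length is = length a}"
    then have "length is = length a" by simp
    from chi[OF this, of i] show "var i powi n * (\<Prod>j\<in>- {i}. weight i j) *
        (shift i (word_coeff is) * (\<Prod>k<length a. shift i (word_support is ! k) powi (a ! k)) *
          shift i (shifts is f)) =
      word_coeff (i # is) * (\<Prod>k<length (n # a). (word_support (i # is) ! k) powi ((n # a) ! k)) *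
        shifts (i # is) f"
      by (simp add: prod.lessThan_Suc_shift del: prod.lessThan_Suc)
  qed
  also have "\<dots> = (\<Sum>is | length is = length (n # a). word_coeff is *
      (\<Prod>k<length (n # a). (word_support is ! k) powi ((n # a) ! k)) * shifts is f)"
    unfolding list.size lists_length_Suc[of "length a"] add_Suc_right add_0_right
    unfolding sum.reindex[OF inj] by (simp add: sum.cartesian_product case_prod_unfold o_def)
  finally show ?case .
qed simp

lemma word_support_form:
  "z \<in> set (word_support is) \<Longrightarrow> \<exists>m i. z = q ^ m * var i"
proof (induction "is" arbitrary: z)
  case (Cons i "is")
  show ?case
  proof (cases "z = var i")
    case True
    then have "z = q ^ 0 * var i" by simp
    then show ?thesis by blast
  next
    case False
    then obtain w where "w \<in> set (word_support is)" "z = shift i w" using Cons.prems by auto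
    with Cons.IH obtain m j where z: "z = shift i (q ^ m * var j)" by blast
    then have "z = q ^ (if j = i then Suc m else m) * var j"
      by (simp add: shift_mult shift_power shift_var)
    then show ?thesis by blast
  qed
qed simp

lemma word_support_distinct: "distinct is \<Longrightarrow> word_support is = map var is"
  by (induction "is") (auto simp: shift_var)

text \<open>If the tail has no repetition, the head occurs there once and its entry is shifted
  exactly once. Otherwise a pair found in the tail survives the further shift, which fixes
  \<open>q\<close>.\<close>

lemma word_support_not_distinct:
  "\<not> distinct is \<Longrightarrow> \<exists>k l. k < l \<and> l < length is \<and> word_support is ! l = q * word_support is ! k"
proof (induction "is")
  case (Cons i "is")
  show ?case
  proof (cases "distinct is")
    case True
    then obtain l where "l < length is" "is ! l = i"
      using Cons.prems by (auto simp: in_set_conv_nth)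
    then have "word_support (i # is) ! Suc l = q * word_support (i # is) ! 0"
      using True by (simp add: word_support_distinct shift_var)
    with \<open>l < length is\<close> show ?thesis by (intro exI[of _ 0] exI[of _ "Suc l"]) simp
  next
    case False
    then obtain k l where "k < l" "l < length is" "word_support is ! l = q * word_support is ! k"
      using Cons.IH by blast
    then show ?thesis
      by (intro exI[of _ "Suc k"] exI[of _ "Suc l"]) (simp add: shift_mult)
  qed
qed simp


section \<open>The rational prefactor\<close>

lemma var_eq_iff [simp]: "var i = (var j :: 'v::linorder ratfun) \<longleftrightarrow> i = j"
  using const_var_eqD[of 1 i 1 j] by auto

lemma q_var_neq: "i \<noteq> j \<Longrightarrow> var j \<noteq> (q * var i :: 'v::linorder ratfun)"
  using const_var_eqD[of q0 i 1 j] by (auto simp: q_eq_const)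

text \<open>Keeps the denominators of the prefactor away from zero at the supports: equality would
  force an algebraic relation between q and t.\<close>

lemma t_q_var_neq: "t * (q ^ m * var i) \<noteq> (q ^ n * var j :: 'v::linorder ratfun)"
proof
  assume "t * (q ^ m * var i) = (q ^ n * var j :: 'v ratfun)"
  then have "const (t0 * q0 ^ m) * var i = (const (q0 ^ n) * var j :: 'v ratfun)"
    by (simp add: t_eq_const q_eq_const const_mult const_power mult.assoc)
  then show False using const_var_eqD t0_q0_neq by fastforce
qed

definition pair_factor :: "'v ratfun \<Rightarrow> 'v ratfun \<Rightarrow> 'v::linorder ratfun" where
  "pair_factor u v = (u - q * v) / ((t - u * inverse v) * (t * u - q * v))"

text \<open>Clearing the inverses leaves one surplus factor \<open>a\<close>, the later numerator of
  \<open>x / (x - y)\<close>.\<close>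

lemma pair_factor_inverse:
  assumes "a \<noteq> 0" "b \<noteq> 0" "t * a \<noteq> b" "t * b \<noteq> q * a"
  shows "pair_factor (inverse a) (inverse b) = (b - q * a) * a / ((t * a - b) * (t * b - q * a))"
proof -
  have "inverse a - q * inverse b = (b - q * a) / (a * b)"
    "t - inverse a * inverse (inverse b) = (t * a - b) / a"
    "t * inverse a - q * inverse b = (t * b - q * a) / (a * b)"
    using assms(1,2) by (simp_all add: field_simps)
  then show ?thesis
    using assms by (simp add: pair_factor_def)
qed

lemma has_value_pair_factor:
  assumes "has_value R p (inverse a)" "has_value S p (inverse b)"
    and "a \<noteq> 0" "b \<noteq> 0" "t * a \<noteq> b" "t * b \<noteq> q * a"
  shows "has_value (pair_factor R S) p (pair_factor (inverse a) (inverse b))"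
proof -
  have "t - inverse a * inverse (inverse b) = (t * a - b) / a"
    "t * inverse a - q * inverse b = (t * b - q * a) / (a * b)"
    using assms(3,4) by (simp_all add: field_simps)
  with assms(3-6) have "(t - inverse a * inverse (inverse b)) * (t * inverse a - q * inverse b) \<noteq> 0"
    by simp
  then show ?thesis
    unfolding pair_factor_def using assms(1,2,4) by (intro has_value_divide has_value_mult has_value_diff
      has_value_inverse has_value_q has_value_t) auto
qed

text \<open>Support entries are powers of q times variables, so an extra factor t prevents every
  cancellation in the denominators. This covers words with repetitions too.\<close>

lemma has_value_prefactor:
  fixes "is" :: "'n::{finite,linorder} list"
  assumes "length is = \<alpha>"
  shows "has_value (\<Prod>j<\<alpha>. \<Prod>i<j. pair_factor (var i) (var j)) (inverse_point (word_support is))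
    (pair_prod (\<lambda>a b. pair_factor (inverse a) (inverse b)) (word_support is))"
proof -
  let ?y = "word_support is"
  have "has_value (pair_factor (var i) (var j)) (inverse_point ?y)
      (pair_factor (inverse (?y ! i)) (inverse (?y ! j)))" if "i < j" "j < \<alpha>" for i j
  proof -
    have val: "has_value (var k) (inverse_point ?y) (inverse (?y ! k))" if "k < \<alpha>" for k
      using has_value_var[of k "inverse_point ?y"] that assms by (simp add: inverse_point_def)
    have "?y ! i \<in> set ?y" "?y ! j \<in> set ?y"
      using that assms by simp_all
    then obtain m k n l where y: "?y ! i = q ^ m * var k" "?y ! j = q ^ n * var l"
      using word_support_form by blast
    \<comment> \<open>The second inequality absorbs \<open>q\<close> into the exponent, hence
      \<open>Suc m\<close>.\<close>
    have "t * ?y ! i \<noteq> ?y ! j" "t * ?y ! j \<noteq> q * ?y ! i"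
      unfolding y using t_q_var_neq[of m k n l] t_q_var_neq[of n l "Suc m" k]
      by (auto simp: mult.assoc)
    moreover have "?y ! i \<noteq> 0" "?y ! j \<noteq> 0"
      unfolding y by simp_all
    ultimately show ?thesis
      using that val[of i] val[of j] by (simp add: has_value_pair_factor)
  qed
  then show ?thesis
    unfolding pair_prod_nth length_word_support assms by (intro has_value_prod) simp_all
qed

lemma prefactor_not_distinct:
  assumes "\<not> distinct is"
  shows "pair_prod (\<lambda>a b. pair_factor (inverse a) (inverse b)) (word_support is) = 0"
proof -
  obtain k l where kl: "k < l" "l < length is" "word_support is ! l = q * word_support is ! k"
    using word_support_not_distinct[OF assms] by blast
  have "pair_factor (inverse (word_support is ! k)) (inverse (word_support is ! l)) = 0"
    by (simp add: kl(3) pair_factor_def)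
  with kl(1,2) show ?thesis by (auto simp: pair_prod_nth)
qed

section \<open>Coefficients of words without repetition\<close>

lemma pair_prod_mult: "pair_prod (\<lambda>x y. f x y * g x y) xs = pair_prod f xs * pair_prod g xs"
  unfolding pair_prod_nth by (simp add: prod.distrib)

lemma pair_prod_cong:
  assumes "distinct xs" "\<And>x y. x \<in> set xs \<Longrightarrow> y \<in> set xs \<Longrightarrow> x \<noteq> y \<Longrightarrow> f x y = g x y"
  shows "pair_prod f xs = pair_prod g xs"
  unfolding pair_prod_nth using assms
  by (intro prod.cong refl assms(2)) (auto simp: nth_eq_iff_index_eq)

lemma pair_prod_map: "pair_prod f (map h xs) = pair_prod (\<lambda>x y. f (h x) (h y)) xs"
  by (induction xs) (auto simp: o_def)

lemma shift_pair_prod: "shift i (pair_prod f xs) = pair_prod (\<lambda>x y. shift i (f x y)) xs"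
  unfolding pair_prod_nth by (simp add: shift_prod)

lemma shift_weight:
  "shift i (weight k j) = (if k = i then (t * (q * var i) - shift i (var j)) / (q * var i - shift i (var j))
     else (t * var k - shift i (var j)) / (var k - shift i (var j)))"
  by (simp add: weight_def shift_hom shift_var)

lemma shift_weight_other [simp]: "k \<noteq> i \<Longrightarrow> j \<noteq> i \<Longrightarrow> shift i (weight k j) = weight k j"
  by (simp add: weight_def shift_hom shift_var)

text \<open>The weights of the head \<open>i\<close> split into those towards later letters and
  those towards letters outside the word. Its shift alters, in the tail's coefficient, only the
  weights towards \<open>i\<close>, which produces the shifted factor of each pair.\<close>

lemma word_coeff_distinct:
  "distinct is \<Longrightarrow> word_coeff is =
    pair_prod (\<lambda>i j. weight i j * shift i (weight j i)) is * (\<Prod>i\<in>set is. \<Prod>j\<in>- set is. weight i j)"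
proof (induction "is")
  case (Cons i "is")
  let ?S = "set is"
  have i: "i \<notin> ?S" "distinct is" using Cons.prems by auto
  \<comment> \<open>The head lies outside the tail but inside the whole word; isolating it separates
    the weights changed by \<open>shift i\<close> from the fixed ones.\<close>
  have compl1: "- {i} = ?S \<union> - insert i ?S" and compl2: "- ?S = insert i (- insert i ?S)"
    using i by auto
  have A: "(\<Prod>j\<in>- {i}. weight i j) = (\<Prod>j\<in>?S. weight i j) * (\<Prod>j\<in>- insert i ?S. weight i j)"
    unfolding compl1 by (rule prod.union_disjoint) auto
  have ne: "k \<noteq> i" if "k \<in> ?S" for k
    using i that by auto
  \<comment> \<open>Pairs within the tail do not involve the variable of index \<open>i\<close>, and
    \<open>shift i\<close> commutes with the inner shift.\<close>
  have "shift i (pair_prod (\<lambda>i j. weight i j * shift i (weight j i)) is) =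
      pair_prod (\<lambda>i j. weight i j * shift i (weight j i)) is"
    unfolding shift_pair_prod
    using i by (intro pair_prod_cong) (simp_all add: ne shift_mult shift_commute[of i])
  moreover have "shift i (\<Prod>k\<in>?S. \<Prod>j\<in>- ?S. weight k j) =
      (\<Prod>k\<in>?S. shift i (weight k i) * (\<Prod>j\<in>- insert i ?S. weight k j))"
    unfolding shift_prod
  proof (intro prod.cong refl)
    fix k assume k: "k \<in> ?S"
    have "(\<Prod>j\<in>- ?S. shift i (weight k j)) =
        shift i (weight k i) * (\<Prod>j\<in>- insert i ?S. shift i (weight k j))"
      unfolding compl2 by simp
    also have "(\<Prod>j\<in>- insert i ?S. shift i (weight k j)) = (\<Prod>j\<in>- insert i ?S. weight k j)"
      using k i by (intro prod.cong refl shift_weight_other) auto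
    finally show "(\<Prod>j\<in>- ?S. shift i (weight k j)) =
        shift i (weight k i) * (\<Prod>j\<in>- insert i ?S. weight k j)" .
  qed
  moreover have "(\<Prod>j\<leftarrow>is. weight i j * shift i (weight j i)) =
      (\<Prod>j\<in>?S. weight i j) * (\<Prod>j\<in>?S. shift i (weight j i))"
    using i(2) by (simp add: prod.distrib flip: prod.distinct_set_conv_list)
  ultimately show ?case
    using i by (simp add: A Cons.IH shift_mult prod.distrib)
qed simp

text \<open>
  For distinct indices the prefactor turns the pair contributions
  into those of the symmetrization formula for Schur functions.
\<close>

lemma prefactor_times_word_coeff:
  assumes "distinct is"
  shows "pair_prod (\<lambda>a b. pair_factor (inverse a) (inverse b)) (word_support is) * word_coeff is =
    pair_prod (\<lambda>x y. x / (x - y)) (map var is) * (\<Prod>i\<in>set is. \<Prod>j\<in>- set is. weight i j)"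
proof -
  \<comment> \<open>The two denominators of the pair factor are the numerators of the two weights,
    and its numerator cancels the denominator of the shifted weight.\<close>
  have "pair_factor (inverse (var i)) (inverse (var j)) * (weight i j * shift i (weight j i)) =
      var i / (var i - var j)" if "i \<noteq> j" for i j :: 'a
  proof -
    have nz: "t * var i - var j \<noteq> 0" "t * var j - q * var i \<noteq> 0" "var j - q * var i \<noteq> (0 :: 'a ratfun)"
      using t_q_var_neq[of 0 i 0 j] t_q_var_neq[of 0 j 1 i] q_var_neq[OF that] by auto
    have w: "shift i (weight j i) = (t * var j - q * var i) / (var j - q * var i)"
      using that by (simp add: shift_weight shift_var)
    have "pair_factor (inverse (var i)) (inverse (var j)) =
        (var j - q * var i) * var i / ((t * var i - var j) * (t * var j - q * var i))"
      using nz by (intro pair_factor_inverse) auto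
    then show ?thesis unfolding w unfolding weight_def using nz by simp
  qed
  then have "pair_prod (\<lambda>i j. pair_factor (inverse (var i)) (inverse (var j)) *
      (weight i j * shift i (weight j i))) is = pair_prod (\<lambda>i j. var i / (var i - var j)) is"
    using assms by (intro pair_prod_cong) auto
  then show ?thesis
    using assms by (simp add: word_support_distinct word_coeff_distinct pair_prod_map pair_prod_mult)
qed


section \<open>The generating multi-current\<close>

text \<open>A subset together with an ordering of it is a word without repetition. The weights
  towards the complement and the product of shifts do not depend on the ordering.\<close>

lemma macdonald_eq_sum_orderings:
  fixes f :: "'n::{finite,linorder} ratfun"
  shows "macdonald a f = (\<Sum>is | length is = length a \<and> distinct is.
    pair_prod (\<lambda>x y. x / (x - y)) (map var is) * (\<Prod>i\<in>set is. \<Prod>j\<in>- set is. weight i j) *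
    (\<Prod>k<length a. (var (is ! k)) powi (a ! k)) * shifts is f)" (is "_ = sum ?F _")
proof -
  have fin: "finite {is. distinct is \<and> set is = I}" for I :: "'n set"
    by (rule finite_subset[OF _ finite_subset_distinct[of UNIV]]) auto
  have "macdonald a f = (\<Sum>I | card I = length a. \<Sum>is | distinct is \<and> set is = I. ?F is)"
    unfolding macdonald_def
  proof (intro sum.cong refl)
    fix I :: "'n set" assume "I \<in> {I. card I = length a}"
    then have I: "card I = length a" by simp
    let ?xs = "sorted_list_of_set I"
    have eq: "{is. distinct is \<and> set is = I} = {is. mset is = mset ?xs}"
    proof (rule Set.set_eqI, rule iffI)
      fix js assume "js \<in> {is. distinct is \<and> set is = I}"
      then show "js \<in> {is. mset is = mset ?xs}"
        using set_eq_iff_mset_eq_distinct[of js ?xs] by simp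
    next
      fix js assume "js \<in> {is. mset is = mset ?xs}"
      then show "js \<in> {is. distinct is \<and> set is = I}"
        using mset_eq_setD[of js ?xs] mset_eq_imp_distinct_iff[of js ?xs] by simp
    qed
    \<comment> \<open>Injectivity of \<open>var\<close> transports orderings of indices to orderings
      of variables.\<close>
    have bij: "bij_betw (map var) {is. mset is = mset ?xs} {ys. mset ys = mset (map var ?xs :: 'n ratfun list)}"
    proof (rule bij_betw_imageI)
      show "inj_on (map (var :: 'n \<Rightarrow> 'n ratfun)) {is. mset is = mset ?xs}"
        using inj_mapI[of "var :: 'n \<Rightarrow> 'n ratfun"] by (auto simp: inj_on_def)
      show "map var ` {is. mset is = mset ?xs} = {ys. mset ys = mset (map var ?xs :: 'n ratfun list)}"
      proof (rule equalityI; rule subsetI)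
        fix ys :: "'n ratfun list" assume "ys \<in> {ys. mset ys = mset (map var ?xs)}"
        then obtain p where p: "p permutes {..<length ?xs}" "permute_list p (map var ?xs) = ys"
          using mset_eq_permutation[of ys "map var ?xs"] by auto
        then have "ys = map var (permute_list p ?xs)" "mset (permute_list p ?xs) = mset ?xs"
          by (simp_all add: permute_list_map)
        then show "ys \<in> map var ` {is. mset is = mset ?xs}" by blast
      qed auto
    qed
    have "gen_schur a (map var ?xs :: 'n ratfun list) = (\<Sum>ys | mset ys = mset (map var ?xs).
        pair_prod (\<lambda>x y. x / (x - y)) ys * (\<Prod>k<length a. (ys ! k) powi (a ! k)))"
      using I by (intro gen_schur_eq_sum_orderings) (auto simp: distinct_map inj_on_def)
    also have "\<dots> = (\<Sum>is | mset is = mset ?xs. pair_prod (\<lambda>x y. x / (x - y)) (map var is) *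
        (\<Prod>k<length a. (map var is ! k) powi (a ! k)))"
      by (rule sum.reindex_bij_betw[OF bij, symmetric])
    finally have schur: "gen_schur a (map var ?xs :: 'n ratfun list) = \<dots>" .
    show "gen_schur a (map var ?xs) * (\<Prod>i\<in>I. \<Prod>j\<in>- I. (t * var i - var j) / (var i - var j)) *
        shifts ?xs f = (\<Sum>is | distinct is \<and> set is = I. ?F is)"
      unfolding schur eq sum_distrib_right
    proof (intro sum.cong refl)
      fix "is" assume "is \<in> {is. mset is = mset ?xs}"
      then have m: "mset is = mset ?xs" by simp
      then have s: "set is = I" "length is = length a"
        using I by (metis finite set_sorted_list_of_set set_mset_mset, metis size_mset length_sorted_list_of_set)
      have "(\<Prod>k<length a. (map var is ! k) powi (a ! k)) = (\<Prod>k<length a. (var (is ! k) :: 'n ratfun) powi (a ! k))"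
        using s by (intro prod.cong) auto
      then show "pair_prod (\<lambda>x y. x / (x - y)) (map var is) * (\<Prod>k<length a. (map var is ! k) powi (a ! k)) *
          (\<Prod>i\<in>I. \<Prod>j\<in>- I. (t * var i - var j) / (var i - var j)) * shifts ?xs f = ?F is"
        using shifts_mset_cong[OF m, of f] s by (simp add: weight_def mult_ac)
    qed
  qed
  also have "\<dots> = sum ?F (\<Union>I\<in>{I. card I = length a}. {is. distinct is \<and> set is = I})"
    by (rule sum.UNION_disjoint[symmetric])
      (use fin in auto)
  also have "(\<Union>I\<in>{I :: 'n set. card I = length a}. {is. distinct is \<and> set is = I}) =
      {is. length is = length a \<and> distinct is}"
    by (auto simp: distinct_card)
  finally show ?thesis .
qed

theorem theorem5p8:
  fixes \<alpha> :: nat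
  assumes "1 \<le> \<alpha>" and "\<alpha> \<le> CARD('n)"
  shows "(multi_current \<alpha> :: 'n::{finite,linorder} current) =
    ratfun_times_current \<alpha>
      (\<Prod>j<\<alpha>. \<Prod>i<j. (var i - q * var j) /
         ((t - var i * inverse (var j)) * (t * var i - q * var j)))
      (current_product \<alpha>)"
proof -
  define R :: "nat ratfun" where "R = (\<Prod>j<\<alpha>. \<Prod>i<j. pair_factor (var i) (var j))"
  let ?W = "{is :: 'n list. length is = \<alpha>}"
  have fin: "finite ?W" using finite_lists_length_eq[of "UNIV :: 'n set" \<alpha>] by simp
  \<comment> \<open>A distinct enumeration of all words turns sums over the list of terms into sums
    over the set of words.\<close>
  then obtain ws where ws: "set ws = ?W" "distinct ws" using finite_distinct_list by blast
  define ts :: "'n delta_term list" where "ts = map (\<lambda>is. (word_coeff is, word_support is, is)) ws"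
  let ?c = "\<lambda>is :: 'n list. pair_prod (\<lambda>a b. pair_factor (inverse a) (inverse b)) (word_support is)"
  let ?\<chi> = "\<lambda>a is. \<Prod>k<\<alpha>. (word_support is ! k) powi (a ! k) :: 'n ratfun"
  have R: "has_value R (inverse_point (word_support is)) (?c is)" if "is \<in> set ws" for "is"
    unfolding R_def using that ws by (intro has_value_prefactor) auto
  have product: "current_product \<alpha> = delta_sum \<alpha> ts"
    unfolding current_product_def delta_sum_def
  proof (rule current_eqI)
    fix a :: "int list" and f :: "'n ratfun" assume "length a = \<alpha>"
    then show "foldr (\<lambda>n F. macdonald [n] \<circ> F) a id f =
        (\<Sum>(c, y, js)\<leftarrow>ts. c * (\<Prod>k<\<alpha>. (y ! k) powi (a ! k)) * shifts js f)"
      unfolding macdonald_composition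
      using ws by (simp add: ts_def o_def sum_list_distinct_conv_sum_set)
  qed
  have "multi_current \<alpha> = delta_sum \<alpha> (map (\<lambda>(c, y, js). (eval_ratfun R (inverse_point y) * c, y, js)) ts)"
    unfolding multi_current_def delta_sum_def
  proof (rule current_eqI)
    fix a :: "int list" and f :: "'n ratfun" assume a: "length a = \<alpha>"
    have "(\<Sum>(c, y, js)\<leftarrow>map (\<lambda>(c, y, js). (eval_ratfun R (inverse_point y) * c, y, js)) ts.
        c * (\<Prod>k<\<alpha>. (y ! k) powi (a ! k)) * shifts js f) =
      (\<Sum>is\<in>?W. eval_ratfun R (inverse_point (word_support is)) * word_coeff is * ?\<chi> a is * shifts is f)"
      using ws by (simp add: ts_def o_def sum_list_distinct_conv_sum_set)
    also have "\<dots> = (\<Sum>is\<in>?W. ?c is * word_coeff is * ?\<chi> a is * shifts is f)"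
      using ws by (intro sum.cong refl) (simp add: eval_ratfun_eqI[OF R])
    \<comment> \<open>Words with a repeated index drop out because the prefactor vanishes at their
      supports.\<close>
    also have "\<dots> = (\<Sum>is | length is = \<alpha> \<and> distinct is. ?c is * word_coeff is * ?\<chi> a is * shifts is f)"
      using fin by (intro sum.mono_neutral_right) (auto simp: prefactor_not_distinct)
    also have "\<dots> = macdonald a f"
      unfolding macdonald_eq_sum_orderings a
    proof (intro sum.cong refl)
      fix "is" :: "'n list" assume "is \<in> {is. length is = \<alpha> \<and> distinct is}"
      then have *: "length is = \<alpha>" "distinct is" by simp_all
      have "?\<chi> a is = (\<Prod>k<\<alpha>. (var (is ! k)) powi (a ! k))"
        using * by (simp add: word_support_distinct)
      then show "?c is * word_coeff is * ?\<chi> a is * shifts is f =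
          pair_prod (\<lambda>x y. x / (x - y)) (map var is) * (\<Prod>i\<in>set is. \<Prod>j\<in>- set is. weight i j) *
          (\<Prod>k<\<alpha>. (var (is ! k)) powi (a ! k)) * shifts is f"
        by (simp only: prefactor_times_word_coeff[OF *(2)])
    qed
    finally show "macdonald a f =
        (\<Sum>(c, y, js)\<leftarrow>map (\<lambda>(c, y, js). (eval_ratfun R (inverse_point y) * c, y, js)) ts.
          c * (\<Prod>k<\<alpha>. (y ! k) powi (a ! k)) * shifts js f)" by simp
  qed
  also have "\<dots> = ratfun_times_current \<alpha> R (delta_sum \<alpha> ts)"
  proof (rule ratfun_times_delta_sum[symmetric])
    fix c y js assume "(c, y, js) \<in> set ts"
    then obtain "is" where "is": "is \<in> set ws" "y = word_support is" by (auto simp: ts_def)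
    have "\<exists>(m::int) i. z = q powi m * var i" if "z \<in> set y" for z
      using word_support_form[of z "is"] that "is" by (metis power_int_of_nat)
    then show "delta_term \<alpha> (c, y, js) \<and> regular_at R (inverse_point y)"
      using "is" ws has_value_regular[OF R[OF "is"(1)]] by (auto simp: delta_term_def)
  qed
  finally show ?thesis
    by (simp add: product R_def pair_factor_def)
qed

end
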